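(* Let $f,g:\mathbb{R}^n\to\mathbb{R}$ be convex and differentiable, $F=f+g$, and assume $\nabla f$ and $\nabla g$ are Lipschitz continuous with Lipschitz constants $L(f)>0$ and $L(g)>0$, respectively. Let $x^*$ be an optimal solution of $\min_{x\in\mathbb{R}^n}F(x)$. If $0<\mu\le\min\{1/L(f),1/L(g)\}$, then the iterates of the algorithm FALM (described in the context) satisfy $$F(y^k)-F(x^* )\le\frac{\|x^0-x^*\|^2}{\mu(k+1)^2}\qquad\text{for all }k\ge1.$$ Hence the sequence $\{F(y^k)\}$ converges to $F(x^* )$, and if $1/(\beta\max\{L(f),L(g)\})\le\mu\le1/\max\{L(f),L(g)\}$ for some $\beta\ge1$, then for every $\epsilon>0$ the number of iterations needed to get an $\epsilon$-optimal solution is at most $\lceil\sqrt{C/\epsilon}-1\rceil$, where $C=\beta\max\{L(f),L(g)\}\|x^0-x^*\|^2$; that is, $F(y^k)-F(x^* )\le\epsilon$ for every $k\ge1$ with $k\ge\lceil\sqrt{C/\epsilon}-1\rceil$.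
   Context: $\|\cdot\|$ is the Euclidean norm. For $\mu>0$ define $$Q_f(u,v):=g(u)+f(v)+\langle\nabla f(v),u-v\rangle+\tfrac{1}{2\mu}\|u-v\|^2,$$ $$Q_g(u,v):=f(u)+g(v)+\langle\nabla g(v),u-v\rangle+\tfrac{1}{2\mu}\|u-v\|^2.$$ A point $x_\epsilon$ is $\epsilon$-optimal if $F(x_\epsilon)-F(x^* )\le\epsilon$. Algorithm FALM (fast alternating linearization method). Choose $\mu>0$ and $x^0=y^0=z^1\in\mathbb{R}^n$, set $t_1=1$. For $k=1,2,\dots$: $x^k:=\arg\min_xQ_g(x,z^k)$; $y^k:=\arg\min_yQ_f(y,x^k)$; $t_{k+1}:=\big(1+\sqrt{1+4t_k^2}\big)/2$; $z^{k+1}:=y^k+\frac{t_k-1}{t_{k+1}}(y^k-y^{k-1})$. *)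

theory Defs
  imports "HOL-Analysis.Analysis"
begin

definition gradient :: "('a::real_inner \<Rightarrow> real) \<Rightarrow> 'a \<Rightarrow> 'a" where
  "gradient f x = (THE D. GDERIV f x :> D)"

lemma GDERIV_gradient:
  fixes f :: "'a::euclidean_space \<Rightarrow> real"
  assumes "f differentiable (at x)"
  shows "GDERIV f x :> gradient f x"
proof -
  obtain f' where f': "(f has_derivative f') (at x)"
    using assms by (auto simp: differentiable_def)
  interpret bounded_linear f' by (rule has_derivative_bounded_linear[OF f'])
  define d where "d = adjoint f' 1"
  have "f' h = h \<bullet> d" for h
    using adjoint_works[OF linear_axioms, of h 1] by (simp add: d_def)
  hence "f' = (\<lambda>h. h \<bullet> d)" by (rule ext)
  hence ex: "GDERIV f x :> d"
    using f' by (simp add: gderiv_def)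
  have "D = d" if D: "GDERIV f x :> D" for D
  proof -
    have "(\<lambda>h. h \<bullet> D) = (\<lambda>h. h \<bullet> d)"
      using D ex unfolding gderiv_def by (rule has_derivative_unique)
    hence "(D - d) \<bullet> D = (D - d) \<bullet> d" by (rule fun_cong)
    hence "(D - d) \<bullet> (D - d) = 0" by (simp add: inner_diff_right)
    thus ?thesis by simp
  qed
  with ex show ?thesis unfolding gradient_def by (rule theI)
qed

definition Q_f ::
  "('a::real_inner \<Rightarrow> real) \<Rightarrow> ('a \<Rightarrow> real) \<Rightarrow> real \<Rightarrow> 'a \<Rightarrow> 'a \<Rightarrow> real" where
  "Q_f f g \<mu> u v =
     g u + f v + gradient f v \<bullet> (u - v) + 1 / (2 * \<mu>) * (norm (u - v))\<^sup>2"

definition Q_g ::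
  "('a::real_inner \<Rightarrow> real) \<Rightarrow> ('a \<Rightarrow> real) \<Rightarrow> real \<Rightarrow> 'a \<Rightarrow> 'a \<Rightarrow> real" where
  "Q_g f g \<mu> u v =
     f u + g v + gradient g v \<bullet> (u - v) + 1 / (2 * \<mu>) * (norm (u - v))\<^sup>2"

text \<open>
  The sequences \<open>x, y, z, t\<close> form a run of the fast alternating linearization method
  with parameter \<open>\<mu>\<close>. The values \<open>z 0\<close> and \<open>t 0\<close> play no role and are unconstrained.
\<close>
definition FALM ::
  "('a::real_inner \<Rightarrow> real) \<Rightarrow> ('a \<Rightarrow> real) \<Rightarrow> real \<Rightarrow>
   (nat \<Rightarrow> 'a) \<Rightarrow> (nat \<Rightarrow> 'a) \<Rightarrow> (nat \<Rightarrow> 'a) \<Rightarrow> (nat \<Rightarrow> real) \<Rightarrow> bool" where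
  "FALM f g \<mu> x y z t \<longleftrightarrow>
     \<mu> > 0 \<and> x 0 = y 0 \<and> y 0 = z 1 \<and> t 1 = 1 \<and>
     (\<forall>k\<ge>1.
        is_arg_min (\<lambda>u. Q_g f g \<mu> u (z k)) (\<lambda>_. True) (x k) \<and>
        is_arg_min (\<lambda>u. Q_f f g \<mu> u (x k)) (\<lambda>_. True) (y k) \<and>
        t (k + 1) = (1 + sqrt (1 + 4 * (t k)\<^sup>2)) / 2 \<and>
        z (k + 1) = y k + ((t k - 1) / t (k + 1)) *\<^sub>R (y k - y (k - 1)))"

end

(*
  Each half-step of the method minimises a quadratic model of F = f + g that lies above F, since
  \<mu> is at most the inverse Lipschitz constant.  The optimality condition and the gradient
  inequality give 2 \<mu> (F u - F p) \<ge> |p - u|^2 - |v - u|^2 for a half-step from v to p.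
  Adding the half-steps z -> x -> y and using F y \<le> F x doubles the constant:
  4 \<mu> (F u - F y) \<ge> |y - u|^2 - |z - u|^2.  Taking u to be the previous iterate and u = xs,
  with weights t (t - 1) and t, shows that 4 \<mu> t_k^2 (F (y_k) - F xs) + |U_k|^2 is
  nonincreasing, where U_k = t_k y_k - (t_k - 1) y_(k-1) - xs; finally t_k \<ge> (k + 1) / 2.
*)

theory Submission
  imports Defs "HOL-Real_Asymp.Real_Asymp"
begin

lemma has_real_derivative_along_line:
  fixes f :: "'a::euclidean_space \<Rightarrow> real"
  assumes "\<And>v. f differentiable (at v)"
  shows "((\<lambda>s. f (v + s *\<^sub>R d)) has_real_derivative gradient f (v + s *\<^sub>R d) \<bullet> d) (at s)"
proof -
  have "(f has_derivative (\<lambda>h. h \<bullet> gradient f (v + s *\<^sub>R d))) (at (v + s *\<^sub>R d))"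
    using GDERIV_gradient[OF assms] by (simp add: gderiv_def)
  then have f: "(f has_derivative (\<lambda>h. h \<bullet> gradient f (v + s *\<^sub>R d)))
      (at ((\<lambda>s. v + s *\<^sub>R d) s))"
    by simp
  have "((\<lambda>s. v + s *\<^sub>R d) has_derivative (\<lambda>h. h *\<^sub>R d)) (at s)"
    by (auto intro!: derivative_eq_intros)
  from has_derivative_compose[OF this f] show ?thesis
    by (auto simp: has_field_derivative_def inner_commute mult.commute elim!: has_derivative_eq_rhs)
qed

text \<open>A convex function of one real variable lies above its tangents. Restricting
  \<open>f\<close> to the line through \<open>v\<close> and \<open>u\<close> carries this over, with
  parameter 0 at \<open>v\<close> and 1 at \<open>u\<close>.\<close>

lemma convex_gradient_le:
  fixes f :: "'a::euclidean_space \<Rightarrow> real"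
  assumes f: "convex_on UNIV f" "\<And>v. f differentiable (at v)"
  shows "f v + gradient f v \<bullet> (u - v) \<le> f u"
proof -
  define h where "h = (\<lambda>s. f (v + s *\<^sub>R (u - v)))"
  have "convex_on UNIV h"
  proof (rule convex_onI)
    fix s a b :: real assume s: "0 < s" "s < 1"
    have "v + ((1 - s) *\<^sub>R a + s *\<^sub>R b) *\<^sub>R (u - v) =
        (1 - s) *\<^sub>R (v + a *\<^sub>R (u - v)) + s *\<^sub>R (v + b *\<^sub>R (u - v))"
      by (simp add: algebra_simps)
    then show "h ((1 - s) *\<^sub>R a + s *\<^sub>R b) \<le> (1 - s) * h a + s * h b"
      unfolding h_def using convex_onD[OF f(1), of s] s by simp
  qed auto
  moreover have "(h has_real_derivative gradient f v \<bullet> (u - v)) (at 0)"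
    using has_real_derivative_along_line[OF f(2), of v "u - v" 0] by (simp add: h_def)
  ultimately have "h 1 - h 0 \<ge> gradient f v \<bullet> (u - v) * (1 - 0)"
    by (intro convex_on_imp_above_tangent[where A = UNIV]) auto
  then show ?thesis by (simp add: h_def)
qed

text \<open>Along the segment from \<open>v\<close> to \<open>u\<close>, \<open>f\<close> minus the
  linear and quadratic terms of the bound has nonpositive derivative, by Cauchy-Schwarz and the
  Lipschitz condition. Comparing the endpoints gives the claim without integrating the
  gradient.\<close>

lemma lipschitz_gradient_descent:
  fixes f :: "'a::euclidean_space \<Rightarrow> real"
  assumes f: "\<And>v. f differentiable (at v)" and L: "L-lipschitz_on UNIV (gradient f)"
  shows "f u \<le> f v + gradient f v \<bullet> (u - v) + L / 2 * (norm (u - v))\<^sup>2"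
proof -
  define d where "d = u - v"
  define h where "h = (\<lambda>s. f (v + s *\<^sub>R d) - s * (gradient f v \<bullet> d) - L / 2 * s\<^sup>2 * (norm d)\<^sup>2)"
  have "h 1 \<le> h 0"
  proof (rule DERIV_nonpos_imp_nonincreasing[where f = h and a = 0 and b = 1])
    fix s :: real assume s: "0 \<le> s" "s \<le> 1"
    have D: "(h has_real_derivative
        (gradient f (v + s *\<^sub>R d) - gradient f v) \<bullet> d - L * s * (norm d)\<^sup>2) (at s)"
      unfolding h_def
      by (auto intro!: derivative_eq_intros has_real_derivative_along_line f simp: inner_diff_left)
    have "(gradient f (v + s *\<^sub>R d) - gradient f v) \<bullet> d
        \<le> norm (gradient f (v + s *\<^sub>R d) - gradient f v) * norm d"
      by (rule norm_cauchy_schwarz)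
    also have "\<dots> \<le> (L * (s * norm d)) * norm d"
      using lipschitz_onD[OF L, of "v + s *\<^sub>R d" v] s
      by (intro mult_right_mono) (auto simp: dist_norm)
    finally have "(gradient f (v + s *\<^sub>R d) - gradient f v) \<bullet> d - L * s * (norm d)\<^sup>2 \<le> 0"
      by (simp add: power2_eq_square mult_ac)
    with D show "\<exists>y. (h has_real_derivative y) (at s) \<and> y \<le> 0" by blast
  qed simp
  then show ?thesis by (simp add: h_def d_def)
qed

lemma Q_f_arg_min_gradient:
  fixes f g :: "'a::euclidean_space \<Rightarrow> real"
  assumes g: "\<And>v. g differentiable (at v)" and "\<mu> \<noteq> 0"
    and min: "is_arg_min (\<lambda>u. Q_f f g \<mu> u v) (\<lambda>_. True) p"
  shows "gradient g p + gradient f v + (1 / \<mu>) *\<^sub>R (p - v) = 0" (is "?G = 0")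
proof -
  have "(g has_derivative (\<lambda>h. h \<bullet> gradient g p)) (at p)"
    using GDERIV_gradient[OF g] by (simp add: gderiv_def)
  then have "((\<lambda>u. Q_f f g \<mu> u v) has_derivative (\<lambda>h. h \<bullet> ?G)) (at p)"
    unfolding Q_f_def power2_norm_eq_inner using \<open>\<mu> \<noteq> 0\<close>
    by (auto intro!: derivative_eq_intros simp: fun_eq_iff inner_commute inner_add_right)
  then have "(\<lambda>h. h \<bullet> ?G) = (\<lambda>_. 0)"
  proof (rule has_derivative_local_min)
    show "\<forall>\<^sub>F u in at p. Q_f f g \<mu> p v \<le> Q_f f g \<mu> u v"
      using min by (auto simp: is_arg_min_linorder)
  qed
  \<comment> \<open>The derivative at the minimiser is the zero functional; evaluate it at
    \<open>?G\<close> itself.\<close>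
  then have "?G \<bullet> ?G = 0" by meson
  then show ?thesis by simp
qed

lemma linearization_step:
  fixes f g :: "'a::euclidean_space \<Rightarrow> real"
  assumes f: "convex_on UNIV f" "\<And>v. f differentiable (at v)"
    and g: "convex_on UNIV g" "\<And>v. g differentiable (at v)"
    and L: "L-lipschitz_on UNIV (gradient f)" "0 < L"
    and \<mu>: "0 < \<mu>" "\<mu> \<le> 1 / L"
    and min: "is_arg_min (\<lambda>u. Q_f f g \<mu> u v) (\<lambda>_. True) p"
  shows "(norm (p - u))\<^sup>2 - (norm (v - u))\<^sup>2 \<le> 2 * \<mu> * ((f u + g u) - (f p + g p))"
proof -
  have "L \<le> 1 / \<mu>" using L \<mu> by (simp add: field_simps)
  then have "L / 2 * (norm (p - v))\<^sup>2 \<le> 1 / \<mu> / 2 * (norm (p - v))\<^sup>2"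
    by (intro mult_right_mono) auto
  with lipschitz_gradient_descent[OF f(2) L(1), of p v]
  have "f p \<le> f v + gradient f v \<bullet> (p - v) + 1 / \<mu> / 2 * (norm (p - v))\<^sup>2" by linarith
  moreover have "f v + gradient f v \<bullet> (u - v) \<le> f u" by (rule convex_gradient_le[OF f])
  moreover have "g p + gradient g p \<bullet> (u - p) \<le> g u" by (rule convex_gradient_le[OF g])
  \<comment> \<open>The tangent of \<open>f\<close> is taken at \<open>v\<close> and that of
    \<open>g\<close> at \<open>p\<close>, so the gradient terms combine into
    \<open>gradient g p + gradient f v\<close>, which is the sum that stationarity of the model
    determines.\<close>
  moreover have "gradient f v \<bullet> (u - v) - gradient f v \<bullet> (p - v) + gradient g p \<bullet> (u - p)
      = (1 / \<mu>) * ((v - p) \<bullet> (u - p))"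
  proof -
    have "gradient g p + gradient f v = (1 / \<mu>) *\<^sub>R (v - p)"
      using Q_f_arg_min_gradient[OF g(2) _ min] \<mu>(1) by (simp add: algebra_simps add_eq_0_iff2)
    then have "(gradient g p + gradient f v) \<bullet> (u - p) = (1 / \<mu>) * ((v - p) \<bullet> (u - p))" by simp
    then show ?thesis by (simp add: inner_diff_right inner_add_left)
  qed
  ultimately have "(1 / \<mu>) * ((v - p) \<bullet> (u - p)) - 1 / \<mu> / 2 * (norm (p - v))\<^sup>2
      \<le> (f u + g u) - (f p + g p)" by linarith
  then have "2 * \<mu> * ((1 / \<mu>) * ((v - p) \<bullet> (u - p)) - 1 / \<mu> / 2 * (norm (p - v))\<^sup>2)
      \<le> 2 * \<mu> * ((f u + g u) - (f p + g p))"
    using \<mu> by (intro mult_left_mono) auto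
  moreover have "2 * \<mu> * ((1 / \<mu>) * ((v - p) \<bullet> (u - p)) - 1 / \<mu> / 2 * (norm (p - v))\<^sup>2)
      = 2 * ((v - p) \<bullet> (u - p)) - (norm (p - v))\<^sup>2"
    using \<mu> by (simp add: field_simps)
  \<comment> \<open>The law of cosines in the triangle \<open>p\<close>, \<open>v\<close>,
    \<open>u\<close>.\<close>
  moreover have "2 * ((v - p) \<bullet> (u - p)) - (norm (p - v))\<^sup>2 = (norm (p - u))\<^sup>2 - (norm (v - u))\<^sup>2"
    unfolding power2_norm_eq_inner
    by (simp add: inner_commute inner_diff_right inner_diff_left)
  ultimately show ?thesis by simp
qed

lemma alternating_step:
  fixes f g :: "'a::euclidean_space \<Rightarrow> real"
  assumes f: "convex_on UNIV f" "\<And>v. f differentiable (at v)"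
    and g: "convex_on UNIV g" "\<And>v. g differentiable (at v)"
    and Lf: "Lf-lipschitz_on UNIV (gradient f)" "0 < Lf"
    and Lg: "Lg-lipschitz_on UNIV (gradient g)" "0 < Lg"
    and \<mu>: "0 < \<mu>" "\<mu> \<le> 1 / Lf" "\<mu> \<le> 1 / Lg"
    and minx: "is_arg_min (\<lambda>u. Q_g f g \<mu> u z) (\<lambda>_. True) x"
    and miny: "is_arg_min (\<lambda>u. Q_f f g \<mu> u x) (\<lambda>_. True) y"
  shows "(norm (y - u))\<^sup>2 - (norm (z - u))\<^sup>2 \<le> 4 * \<mu> * ((f u + g u) - (f y + g y))"
proof -
  have stepy: "(norm (y - w))\<^sup>2 - (norm (x - w))\<^sup>2 \<le> 2 * \<mu> * ((f w + g w) - (f y + g y))" for w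
    by (rule linearization_step[OF f g Lf \<mu>(1,2) miny])
  \<comment> \<open>\<open>Q_g\<close> is \<open>Q_f\<close> with the two functions exchanged, so
    one half-step lemma serves both updates.\<close>
  have "is_arg_min (\<lambda>u. Q_f g f \<mu> u z) (\<lambda>_. True) x"
    using minx by (simp add: Q_f_def Q_g_def)
  from linearization_step[OF g f Lg \<mu>(1,3) this, of u]
  have stepx: "(norm (x - u))\<^sup>2 - (norm (z - u))\<^sup>2 \<le> 2 * \<mu> * ((f u + g u) - (f x + g x))"
    by (simp add: add.commute)
  \<comment> \<open>Comparing the second half-step with its own starting point \<open>x\<close>
    shows that it does not increase the objective. Hence the value at \<open>x\<close> in
    \<open>stepx\<close> may be replaced by the one at \<open>y\<close>.\<close>
  have "0 \<le> 2 * \<mu> * ((f x + g x) - (f y + g y))"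
    using order_trans[OF zero_le_power2 stepy[of x, simplified]] by (simp add: algebra_simps)
  with stepy[of u] stepx show ?thesis by (simp add: algebra_simps)
qed

text \<open>Used with \<open>a\<close> the new iterate and with \<open>a\<close> the extrapolated
  point, \<open>b\<close> the previous iterate and \<open>p\<close> the optimum. The last term does
  not involve \<open>a\<close>, so it cancels when the two instances are subtracted.\<close>

lemma weighted_norm_identity:
  fixes a b p :: "'a::real_inner"
  shows "s * (s - 1) * (norm (a - b))\<^sup>2 + s * (norm (a - p))\<^sup>2 =
    (norm (s *\<^sub>R a - (s - 1) *\<^sub>R b - p))\<^sup>2 + (s - 1) * (norm (b - p))\<^sup>2"
  unfolding power2_norm_eq_inner
  by (simp add: inner_diff_right inner_diff_left inner_commute algebra_simps)

text \<open>\<open>s'\<close> is the larger root of the quadratic equation in the first claim. That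
  equation makes the energy telescope; the third claim gives the linear growth of the weights behind
  the quadratic rate.\<close>

lemma FALM_weight_step:
  fixes s s' :: real
  assumes "s' = (1 + sqrt (1 + 4 * s\<^sup>2)) / 2"
  shows "s'\<^sup>2 - s' = s\<^sup>2" and "s' \<ge> 1" and "s' \<ge> s + 1 / 2"
proof -
  have sq: "(sqrt (1 + 4 * s\<^sup>2))\<^sup>2 = 1 + 4 * s\<^sup>2" by (simp add: add_nonneg_nonneg)
  have eq: "sqrt (1 + 4 * s\<^sup>2) = 2 * s' - 1" using assms by simp
  with sq have "(2 * s' - 1)\<^sup>2 = 1 + 4 * s\<^sup>2" by simp
  then show "s'\<^sup>2 - s' = s\<^sup>2" by (simp add: power2_eq_square algebra_simps)
  have "1 \<le> 2 * s' - 1" unfolding eq[symmetric] by simp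
  then show "s' \<ge> 1" by simp
  have "2 * s \<le> sqrt (1 + 4 * s\<^sup>2)" by (rule real_le_rsqrt) (simp add: power2_eq_square)
  then show "s' \<ge> s + 1 / 2" using assms by simp
qed

lemma FALM_bound:
  fixes f g :: "'a::euclidean_space \<Rightarrow> real"
  assumes f: "convex_on UNIV f" "\<And>v. f differentiable (at v)"
    and g: "convex_on UNIV g" "\<And>v. g differentiable (at v)"
    and Lf: "Lf-lipschitz_on UNIV (gradient f)" "0 < Lf"
    and Lg: "Lg-lipschitz_on UNIV (gradient g)" "0 < Lg"
    and \<mu>: "0 < \<mu>" "\<mu> \<le> 1 / Lf" "\<mu> \<le> 1 / Lg"
    and opt: "\<And>u. f xs + g xs \<le> f u + g u"
    and falm: "FALM f g \<mu> x y z t"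
    and k: "k \<ge> 1"
  shows "(f (y k) + g (y k)) - (f xs + g xs) \<le> (norm (x 0 - xs))\<^sup>2 / (\<mu> * (real k + 1)\<^sup>2)"
proof -
  define v where "v k = (f (y k) + g (y k)) - (f xs + g xs)" for k
  define U where "U k = t k *\<^sub>R y k - (t k - 1) *\<^sub>R y (k - 1) - xs" for k
  have v0: "v k \<ge> 0" for k using opt by (simp add: v_def)
  have rate: "(norm (y k - u))\<^sup>2 - (norm (z k - u))\<^sup>2 \<le> 4 * \<mu> * ((f u + g u) - (f (y k) + g (y k)))"
    if "k \<ge> 1" for k u
    using falm that unfolding FALM_def by (intro alternating_step[OF f g Lf Lg \<mu>, where x = "x k"]) auto
  have t1: "t 1 = 1" and init: "x 0 = z 1" using falm by (auto simp: FALM_def)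
  have tS: "t (Suc k) = (1 + sqrt (1 + 4 * (t k)\<^sup>2)) / 2" if "k \<ge> 1" for k
    using falm that by (simp add: FALM_def)
  have zS: "z (Suc k) = y k + ((t k - 1) / t (Suc k)) *\<^sub>R (y k - y (k - 1))" if "k \<ge> 1" for k
    using falm that by (simp add: FALM_def)
  have energy: "4 * \<mu> * ((t k)\<^sup>2 * v k) + (norm (U k))\<^sup>2 \<le> (norm (x 0 - xs))\<^sup>2"
    if "k \<ge> 1" for k
    using that
  proof (induction k rule: dec_induct)
    case base
    \<comment> \<open>Since \<open>t 1 = 1\<close>, the coefficient of \<open>y 0\<close> in
      \<open>U 1\<close> vanishes and \<open>U 1 = y 1 - xs\<close>.\<close>
    show ?case using rate[of 1 xs] t1 init by (simp add: U_def v_def algebra_simps)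
  next
    case (step k)
    note IH = step.IH and k = step.hyps(1)
    define s where "s = t (Suc k)"
    have s: "s\<^sup>2 - s = (t k)\<^sup>2" "s \<ge> 1" using FALM_weight_step[OF tS[OF k]] by (auto simp: s_def)
    have A: "(norm (y (Suc k) - y k))\<^sup>2 - (norm (z (Suc k) - y k))\<^sup>2 \<le> 4 * \<mu> * (v k - v (Suc k))"
      unfolding v_def using rate[of "Suc k" "y k"] by (simp add: algebra_simps)
    have B: "(norm (y (Suc k) - xs))\<^sup>2 - (norm (z (Suc k) - xs))\<^sup>2 \<le> 4 * \<mu> * (- v (Suc k))"
      using rate[of "Suc k" xs] by (simp add: v_def)
    \<comment> \<open>This is what the extrapolation coefficient is designed for: the combination
      that yields \<open>U (Suc k)\<close> from the new iterate yields \<open>U k\<close> from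
      \<open>z (Suc k)\<close>.\<close>
    have UZ: "s *\<^sub>R z (Suc k) - (s - 1) *\<^sub>R y k - xs = U k"
    proof -
      have "s *\<^sub>R z (Suc k) = s *\<^sub>R y k + (t k - 1) *\<^sub>R (y k - y (k - 1))"
        using s by (simp add: zS[OF k] s_def[symmetric] scaleR_add_right)
      then show ?thesis by (simp add: U_def algebra_simps)
    qed
    have UY: "s *\<^sub>R y (Suc k) - (s - 1) *\<^sub>R y k - xs = U (Suc k)"
      by (simp add: U_def s_def)
    \<comment> \<open>Both weights, \<open>s * (s - 1)\<close> and \<open>s\<close>, are nonnegative
      because \<open>s \<ge> 1\<close>.\<close>
    have "s * (s - 1) * ((norm (y (Suc k) - y k))\<^sup>2 - (norm (z (Suc k) - y k))\<^sup>2)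
        \<le> s * (s - 1) * (4 * \<mu> * (v k - v (Suc k)))"
      using s A by (intro mult_left_mono) auto
    moreover have "s * ((norm (y (Suc k) - xs))\<^sup>2 - (norm (z (Suc k) - xs))\<^sup>2)
        \<le> s * (4 * \<mu> * (- v (Suc k)))"
      using s B by (intro mult_left_mono) auto
    ultimately have "(norm (U (Suc k)))\<^sup>2 - (norm (U k))\<^sup>2
        \<le> s * (s - 1) * (4 * \<mu> * (v k - v (Suc k))) + s * (4 * \<mu> * (- v (Suc k)))"
      using weighted_norm_identity[of s "y (Suc k)" "y k" xs]
        weighted_norm_identity[of s "z (Suc k)" "y k" xs]
      unfolding UZ UY by (simp add: right_diff_distrib)
    also have "\<dots> = 4 * \<mu> * ((s\<^sup>2 - s) * v k - s\<^sup>2 * v (Suc k))"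
      by (simp add: power2_eq_square algebra_simps)
    \<comment> \<open>By \<open>s\<^sup>2 - s = (t k)\<^sup>2\<close>, the coefficient of
      \<open>v k\<close> equals the one in the induction hypothesis.\<close>
    finally show ?case using IH unfolding s(1) by (simp add: s_def algebra_simps)
  qed
  \<comment> \<open>The weights start at 1 and grow by at least 1/2 per step.\<close>
  have tk: "t k \<ge> (real k + 1) / 2" using k
  proof (induction k rule: dec_induct)
    case (step k)
    then show ?case using FALM_weight_step(3)[OF tS[of k]] by simp
  qed (simp add: t1[simplified])
  have "\<mu> * (real k + 1)\<^sup>2 * v k = 4 * \<mu> * (((real k + 1) / 2)\<^sup>2 * v k)"
    by (simp add: power2_eq_square)
  also have "\<dots> \<le> 4 * \<mu> * ((t k)\<^sup>2 * v k)"
    using tk \<mu> v0 by (intro mult_left_mono mult_right_mono power_mono) auto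
  also have "\<dots> \<le> (norm (x 0 - xs))\<^sup>2" using energy[OF k] zero_le_power2[of "norm (U k)"] by linarith
  finally show ?thesis using \<mu> by (simp add: v_def[symmetric] pos_le_divide_eq mult.commute)
qed

theorem corollary3p5:
  fixes f g F :: "real ^ 'n \<Rightarrow> real"
    and Lf Lg \<mu> :: real
    and x y z :: "nat \<Rightarrow> real ^ 'n"
    and t :: "nat \<Rightarrow> real"
    and xs :: "real ^ 'n"
  assumes "convex_on UNIV f" and "convex_on UNIV g"
    and "\<And>v. f differentiable (at v)" and "\<And>v. g differentiable (at v)"
    and "F = (\<lambda>v. f v + g v)"
    and "Lf > 0" and "Lg > 0"
    and "Lf-lipschitz_on UNIV (gradient f)"
    and "Lg-lipschitz_on UNIV (gradient g)"
    and "is_arg_min F (\<lambda>_. True) xs"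
    and "0 < \<mu>" and "\<mu> \<le> min (1 / Lf) (1 / Lg)"
    and "FALM f g \<mu> x y z t"
  shows "(\<forall>k\<ge>1. F (y k) - F xs \<le> (norm (x 0 - xs))\<^sup>2 / (\<mu> * (real k + 1)\<^sup>2)) \<and>
    (\<lambda>k. F (y k)) \<longlonglongrightarrow> F xs \<and>
    (\<forall>\<beta>\<ge>1. 1 / (\<beta> * max Lf Lg) \<le> \<mu> \<and> \<mu> \<le> 1 / max Lf Lg \<longrightarrow>
       (let C = \<beta> * max Lf Lg * (norm (x 0 - xs))\<^sup>2
        in \<forall>\<epsilon>>0. \<forall>k\<ge>1. int k \<ge> \<lceil>sqrt (C / \<epsilon>) - 1\<rceil> \<longrightarrow> F (y k) - F xs \<le> \<epsilon>))"
proof -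
  have F: "F u = f u + g u" for u using assms(5) by simp
  have opt: "F xs \<le> F u" for u using assms(10) by (simp add: is_arg_min_linorder)
  have bound: "F (y k) - F xs \<le> (norm (x 0 - xs))\<^sup>2 / (\<mu> * (real k + 1)\<^sup>2)" if "k \<ge> 1" for k
    unfolding F using assms that opt[unfolded F]
    by (intro FALM_bound[where Lf = Lf and Lg = Lg and z = z and t = t]) auto
  have "(\<lambda>k. F (y k) - F xs) \<longlonglongrightarrow> 0"
  proof (rule tendsto_sandwich)
    show "\<forall>\<^sub>F k in sequentially. 0 \<le> F (y k) - F xs" using opt by simp
    show "\<forall>\<^sub>F k in sequentially. F (y k) - F xs \<le> (norm (x 0 - xs))\<^sup>2 / (\<mu> * (real k + 1)\<^sup>2)"
      using bound by (rule eventually_sequentiallyI)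
    have "filterlim (\<lambda>k. \<mu> * (real k + 1)\<^sup>2) at_top sequentially"
      using \<open>0 < \<mu>\<close> by real_asymp
    then show "(\<lambda>k. (norm (x 0 - xs))\<^sup>2 / (\<mu> * (real k + 1)\<^sup>2)) \<longlonglongrightarrow> 0"
      by (rule real_tendsto_divide_at_top[OF tendsto_const])
  qed simp
  then have lim: "(\<lambda>k. F (y k)) \<longlonglongrightarrow> F xs" by (simp add: LIM_zero_iff)
  have "F (y k) - F xs \<le> \<epsilon>"
    if \<beta>: "\<beta> \<ge> 1" "1 / (\<beta> * max Lf Lg) \<le> \<mu>" and "\<epsilon> > 0" and "k \<ge> 1"
      and k: "int k \<ge> \<lceil>sqrt (\<beta> * max Lf Lg * (norm (x 0 - xs))\<^sup>2 / \<epsilon>) - 1\<rceil>" for \<beta> \<epsilon> k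
  proof -
    define M where "M = \<beta> * max Lf Lg"
    define R where "R = (norm (x 0 - xs))\<^sup>2"
    have M: "0 < M" using \<beta>(1) \<open>Lf > 0\<close> by (simp add: M_def less_max_iff_disj)
    have "1 \<le> \<mu> * M" using \<beta>(2) M by (simp add: M_def[symmetric] pos_divide_le_eq)
    \<comment> \<open>An integer dominates a ceiling iff it dominates the real number under it;
      moving the 1 across produces the \<open>k + 1\<close> of the rate.\<close>
    have "sqrt (M * R / \<epsilon>) \<le> real k + 1"
      using k unfolding ceiling_le_iff by (simp add: M_def R_def)
    then have "M * R / \<epsilon> \<le> (real k + 1)\<^sup>2" by (rule sqrt_le_D)
    then have "M * R \<le> (real k + 1)\<^sup>2 * \<epsilon>" using \<open>\<epsilon> > 0\<close> by (simp add: pos_divide_le_eq)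
    \<comment> \<open>The lower bound on \<open>\<mu>\<close> says \<open>1 / \<mu> \<le> M\<close>,
      so the factor \<open>1 / \<mu>\<close> in the rate costs at most \<open>M\<close>.\<close>
    have "R \<le> \<mu> * (M * R)"
      using mult_right_mono[OF \<open>1 \<le> \<mu> * M\<close>, of R] by (simp add: R_def mult.assoc)
    also have "\<dots> \<le> \<mu> * ((real k + 1)\<^sup>2 * \<epsilon>)"
      using \<open>M * R \<le> _\<close> \<open>0 < \<mu>\<close> by (intro mult_left_mono) auto
    finally have "R / (\<mu> * (real k + 1)\<^sup>2) \<le> \<epsilon>"
      using \<open>0 < \<mu>\<close> by (subst pos_divide_le_eq) (auto simp: mult_ac)
    with bound[OF \<open>k \<ge> 1\<close>] show ?thesis by (simp add: R_def)
  qed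
  with bound lim show ?thesis by (auto simp: Let_def)
qed

end
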